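(* Let $g$ be a simplest rational element of $\Lambda_-^{\sigma}\mathrm{GL}(3,\mathbb{C})$. Then there exist $\alpha\in\mathbb{C}_*$ and a complex line $\ell=\mathbb{C}\cdot(a,b,1)\subset\mathbb{C}^3$ with $\ell\nsubseteq\Delta$ (equivalently, $a,b\in\mathbb{C}$ with $2ab\neq 1$) such that either $g=g_{\alpha,\ell}$ (rank 1 type) or $g=h_{\alpha,\ell}$ (rank 2 type).
   Context: Notation. $\mathbb{C}_*=\mathbb{C}\setminus\{0\}$, $\epsilon=e^{\pi i/3}$. $\mathcal{O}_r=\{|\lambda|<r\}$, $\mathcal{O}_{1/r}=\{\lambda\in\mathbb{C}\cup\{\infty\}:|\lambda|>1/r\}$, where $0<r<1$ is sufficiently small (depending on the element considered). For a matrix group $G$, $\Lambda_-G$ is the set of holomorphic maps $f:\mathcal{O}_r\cup\mathcal{O}_{1/r}\to G$ with $f(\infty)=I$. For an invertible $3\times 3$ matrix $g$ put $\sigma(g)=T(g^t)^{-1}T^{-1}$ with $T=\begin{pmatrix}0&1&0\\-\epsilon&0&0\\0&0&\epsilon^2\end{pmatrix}$. $\Lambda_-^{\sigma}G$ is the subgroup of $g\in\Lambda_-G$ with $\sigma(g(\lambda))=g(\epsilon\lambda)$. Equivalently, $Qg(\lambda)Q^{-1}=g(\epsilon^4\lambda)$ and $P(g(\lambda)^t)^{-1}P=g(-\lambda)$, where $Q=\mathrm{diag}(\epsilon^4,\epsilon^2,1)$ and $P=\begin{pmatrix}0&1&0\\1&0&0\\0&0&1\end{pmatrix}$. By the $Q$-condition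 the pole set of a rational element is invariant under multiplication by $\epsilon^2$. A simplest rational element of $\Lambda_-^\sigma\mathrm{GL}(3,\mathbb{C})$ is an element that is rational in $\lambda$, whose only poles are three simple poles at $\alpha,\epsilon^2\alpha,\epsilon^4\alpha$ for some $\alpha\in\mathbb{C}_*$, and that is nontrivial, i.e. not the scalar element $\frac{\lambda^3+\alpha^3}{\lambda^3-\alpha^3}I$. $\Delta=\{(z_1,z_2,z_3)\in\mathbb{C}^3: 2z_1z_2=z_3^2 \text{ or } z_3=0\}$. A line $\ell\nsubseteq\Delta$ through the origin can be written uniquely as $\mathbb{C}\cdot(a,b,1)$ with $2ab\ne1$. For $\alpha\in\mathbb{C}_*$ and $\ell=\mathbb{C}\cdot(a,b,1)\nsubseteq\Delta$: $$g_{\alpha,\ell}(\lambda)=I+\frac{2}{\lambda^3-\alpha^3}\begin{pmatrix}\frac{\alpha^3ab}{2ab-1}&\frac{\alpha\lambda^2b^2}{2ab-1}&\frac{\alpha^2\lambda b}{2ab-1}\\ \alpha^2\lambda a^2&\alpha^3ab&\alpha\lambda^2a\\ \alpha\lambda^2a&\alpha^2\lambda b&\alpha^3\end{pmatrix},$$ $$h_{\alpha,\ell}(\lambda)=I+\frac{2}{\lambda^3-\alpha^3}\begin{pmatrix}\frac{\alpha^3(ab-1)}{2ab-1}&\frac{-\alpha\lambda^2b^2}{2ab-1}&\frac{\alpha^2\lambda b}{2ab-1}\\ \alpha^2\lambda a^2&\alpha^3(1-ab)&-\alpha\lambda^2a\\ -\alpha\lambda^2a&\alpha^2\lambda b&0\end{pmatrix}.$$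 *)

theory Defs
  imports "HOL-Complex_Analysis.Complex_Analysis"
begin

type_synonym cmat3 = "complex^3^3"

definition eps :: complex where
  "eps = exp (of_real pi * \<i> / 3)"

text \<open>
  The finite part of \<open>O_r \<union> O_{1/r}\<close>.  A loop is represented by its restriction to this set; its
  value at infinity is not stored, since every element of \<open>\<Lambda>\<^sub>-G\<close> takes the value \<open>I\<close> there.
\<close>
definition loop_domain :: "real \<Rightarrow> complex set" where
  "loop_domain r = {z. norm z < r \<or> norm z > 1 / r}"

text \<open>
  Holomorphy on the neighbourhood \<open>O_{1/r}\<close> of infinity, together with the value \<open>I\<close> at infinity,
  is expressed in the chart \<open>w = 1/z\<close> (the third conjunct).
\<close>
definition Lambda_minus :: "real \<Rightarrow> cmat3 set \<Rightarrow> (complex \<Rightarrow> cmat3) set" where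
  "Lambda_minus r G = {f.
     (\<forall>z\<in>loop_domain r. f z \<in> G) \<and>
     (\<forall>i j. (\<lambda>z. f z $ i $ j) holomorphic_on ball 0 r) \<and>
     (\<forall>i j. (\<lambda>w. (if w = 0 then mat 1 else f (1 / w)) $ i $ j) holomorphic_on ball 0 r)}"

definition GL3 :: "cmat3 set" where
  "GL3 = {A. invertible A}"

definition Tmat :: cmat3 where
  "Tmat = vector [vector [0, 1, 0],
                  vector [- eps, 0, 0],
                  vector [0, 0, eps ^ 2]]"

definition sigma :: "cmat3 \<Rightarrow> cmat3" where
  "sigma A = Tmat ** matrix_inv (transpose A) ** matrix_inv Tmat"

text \<open>At infinity the \<open>\<sigma>\<close>-condition reads \<open>\<sigma>(I) = I\<close>, which always holds.\<close>
definition Lambda_minus_sigma :: "real \<Rightarrow> cmat3 set \<Rightarrow> (complex \<Rightarrow> cmat3) set" where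
  "Lambda_minus_sigma r G =
     {g \<in> Lambda_minus r G. \<forall>z\<in>loop_domain r. sigma (g z) = g (eps * z)}"

text \<open>
  A representative \<open>R\<close> of a matrix of rational functions with common denominator \<open>D\<close>.  At the
  finitely many zeros of \<open>D\<close> the value of \<open>R\<close> is unconstrained; these are poles or removable
  singularities, and the notions of pole and pole order below do not depend on the value there.
\<close>
definition rational_matrix_fun :: "(complex \<Rightarrow> cmat3) \<Rightarrow> bool" where
  "rational_matrix_fun R \<longleftrightarrow> (\<exists>(N :: complex poly ^3^3) (D :: complex poly). D \<noteq> 0 \<and>
     (\<forall>z i j. poly D z \<noteq> 0 \<longrightarrow> R z $ i $ j = poly (N $ i $ j) z / poly D z))"

definition matrix_pole :: "(complex \<Rightarrow> cmat3) \<Rightarrow> complex \<Rightarrow> bool" where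
  "matrix_pole R p \<longleftrightarrow> (\<exists>i j. is_pole (\<lambda>z. R z $ i $ j) p)"

definition matrix_simple_pole :: "(complex \<Rightarrow> cmat3) \<Rightarrow> complex \<Rightarrow> bool" where
  "matrix_simple_pole R p \<longleftrightarrow> matrix_pole R p \<and>
     (\<forall>i j. is_pole (\<lambda>z. R z $ i $ j) p \<longrightarrow> zorder (\<lambda>z. R z $ i $ j) p = - 1)"

text \<open>
  \<open>R\<close> is the rational continuation of \<open>g\<close> to the whole plane, so the poles of \<open>g\<close> are those of \<open>R\<close>.
  There is never a pole at infinity, as \<open>g\<close> is holomorphic there.
\<close>
definition simplest_rational :: "real \<Rightarrow> (complex \<Rightarrow> cmat3) \<Rightarrow> bool" where
  "simplest_rational r g \<longleftrightarrow> g \<in> Lambda_minus_sigma r GL3 \<and>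
     (\<exists>R \<alpha>. rational_matrix_fun R \<and> (\<forall>z\<in>loop_domain r. R z = g z) \<and> \<alpha> \<noteq> 0 \<and>
        {p. matrix_pole R p} = {\<alpha>, eps ^ 2 * \<alpha>, eps ^ 4 * \<alpha>} \<and>
        (\<forall>p\<in>{\<alpha>, eps ^ 2 * \<alpha>, eps ^ 4 * \<alpha>}. matrix_simple_pole R p) \<and>
        \<not> (\<forall>z\<in>loop_domain r. g z = mat ((z ^ 3 + \<alpha> ^ 3) / (z ^ 3 - \<alpha> ^ 3))))"

definition Delta :: "(complex^3) set" where
  "Delta = {z. 2 * z $ 1 * z $ 2 = (z $ 3) ^ 2 \<or> z $ 3 = 0}"

definition line :: "complex \<Rightarrow> complex \<Rightarrow> (complex^3) set" where
  "line a b = vec.span {vector [a, b, 1]}"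

lemma line_subset_Delta_iff: "line a b \<subseteq> Delta \<longleftrightarrow> 2 * a * b = 1"
proof
  assume "line a b \<subseteq> Delta"
  moreover have "vector [a, b, 1] \<in> line a b"
    unfolding line_def by (intro vec.span_base) simp
  ultimately show "2 * a * b = 1" by (auto simp: Delta_def)
next
  assume ab: "2 * a * b = 1"
  have "2 * (k * a) * (k * b) = k ^ 2" for k
  proof -
    have "2 * (k * a) * (k * b) = k ^ 2 * (2 * a * b)" by (simp add: power2_eq_square)
    then show ?thesis using ab by simp
  qed
  then show "line a b \<subseteq> Delta"
    by (auto simp: line_def Delta_def vec.span_singleton)
qed

definition g_loop :: "complex \<Rightarrow> complex \<Rightarrow> complex \<Rightarrow> complex \<Rightarrow> cmat3" where
  "g_loop \<alpha> a b z = mat 1 + map_matrix (\<lambda>x. 2 / (z ^ 3 - \<alpha> ^ 3) * x) (vector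
     [vector [\<alpha> ^ 3 * a * b / (2 * a * b - 1),
              \<alpha> * z ^ 2 * b ^ 2 / (2 * a * b - 1),
              \<alpha> ^ 2 * z * b / (2 * a * b - 1)],
      vector [\<alpha> ^ 2 * z * a ^ 2, \<alpha> ^ 3 * a * b, \<alpha> * z ^ 2 * a],
      vector [\<alpha> * z ^ 2 * a, \<alpha> ^ 2 * z * b, \<alpha> ^ 3]])"

definition h_loop :: "complex \<Rightarrow> complex \<Rightarrow> complex \<Rightarrow> complex \<Rightarrow> cmat3" where
  "h_loop \<alpha> a b z = mat 1 + map_matrix (\<lambda>x. 2 / (z ^ 3 - \<alpha> ^ 3) * x) (vector
     [vector [\<alpha> ^ 3 * (a * b - 1) / (2 * a * b - 1),
              - (\<alpha> * z ^ 2 * b ^ 2) / (2 * a * b - 1),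
              \<alpha> ^ 2 * z * b / (2 * a * b - 1)],
      vector [\<alpha> ^ 2 * z * a ^ 2, \<alpha> ^ 3 * (1 - a * b), - (\<alpha> * z ^ 2 * a)],
      vector [- (\<alpha> * z ^ 2 * a), \<alpha> ^ 2 * z * b, 0]])"

end

theory Submission
  imports Defs "HOL-Computational_Algebra.Fundamental_Theorem_Algebra"
begin

no_notation fps_nth (infixl "$" 75)

text \<open>
  Clearing the three simple poles turns \<open>g\<close> into a polynomial matrix \<open>M(z) = (z\<^sup>3 - \<alpha>\<^sup>3) g(z)\<close> of degree
  three with leading coefficient \<open>I\<close>.  Applying the \<open>\<sigma>\<close>-condition twice gives the \<open>Q\<close>-condition, which
  leaves a single residue class of exponents modulo 3 in every entry and hence nine free coefficients.
  The \<open>\<sigma>\<close>-condition itself becomes \<open>M(\<epsilon>z) T M(z)\<^sup>t = (\<alpha>\<^sup>6 - z\<^sup>6) T\<close>.  Comparing coefficients, its solutions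
  are, for each sign of the constant term \<open>\<plusminus>\<alpha>\<^sup>3\<close> of the entry \<open>(3,3)\<close>, the two-parameter family of the
  theorem and one exceptional scalar matrix; the latter is the excluded scalar element for the sign \<open>+\<close>
  and the pole-free identity for the sign \<open>-\<close>.
\<close>

section \<open>Rational functions with simple poles\<close>

text \<open>Every nonconstant \<open>D\<close> has a root, which by comparison of orders is also a
  root of \<open>Q\<close>. Cancelling the linear factor from both lowers both orders at that root
  by one, so the inequality survives and induction on the degree applies.\<close>

lemma dvd_if_order_le:
  fixes D Q :: "'a :: alg_closed_field poly"
  assumes "Q \<noteq> 0" "\<And>p. order p D \<le> order p Q" "D \<noteq> 0"
  shows "D dvd Q"
  using assms
proof (induction "degree D" arbitrary: D Q)
  case 0
  then have "is_unit D" by (simp add: is_unit_iff_degree)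
  then show ?case by (rule unit_imp_dvd)
next
  case (Suc n)
  have "degree D > 0" using Suc.hyps(2) by simp
  from alg_closed_imp_poly_has_root[OF this] obtain a where a: "poly D a = 0"
    by blast
  then obtain D' where D': "D = [:- a, 1:] * D'" unfolding poly_eq_0_iff_dvd by (rule dvdE)
  have "order a D \<noteq> 0" using a Suc.prems by (simp add: order_root)
  then have "order a Q \<noteq> 0" using Suc.prems(2)[of a] by linarith
  then have "poly Q a = 0" by (simp add: order_root)
  then obtain Q' where Q': "Q = [:- a, 1:] * Q'" unfolding poly_eq_0_iff_dvd by (rule dvdE)
  have nz: "D' \<noteq> 0" "Q' \<noteq> 0" using D' Q' Suc.prems by auto
  have "order p D' \<le> order p Q'" for p
    using Suc.prems(2)[of p] Suc.prems(1,3) unfolding D' Q' by (simp add: order_mult del: mult_pCons_left)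
  moreover have "n = degree D'"
    using Suc.hyps(2) nz unfolding D' by (simp add: degree_mult_eq del: mult_pCons_left)
  ultimately have "D' dvd Q'" using Suc.hyps(1) nz by blast
  then show ?case unfolding D' Q' by (rule mult_dvd_mono[OF dvd_refl])
qed

text \<open>Splitting off all factors \<open>z - p\<close> leaves a quotient \<open>N1 / D1\<close>
  that is holomorphic and nonzero at \<open>p\<close>, so \<open>f\<close> is this quotient times a
  power of \<open>z - p\<close> on a punctured neighbourhood. The value of \<open>f\<close> at a
  zero of \<open>D\<close> does not enter.\<close>

lemma zorder_rational:
  fixes N D :: "complex poly"
  assumes "N \<noteq> 0" "D \<noteq> 0" and f: "\<And>z. poly D z \<noteq> 0 \<Longrightarrow> f z = poly N z / poly D z"
  shows "zorder f p = int (order p N) - int (order p D)"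
    and "order p N < order p D \<Longrightarrow> is_pole f p"
proof -
  obtain N1 where N1: "N = [:- p, 1:] ^ order p N * N1" "\<not> [:- p, 1:] dvd N1"
    using order_decomp[OF assms(1)] by blast
  obtain D1 where D1: "D = [:- p, 1:] ^ order p D * D1" "\<not> [:- p, 1:] dvd D1"
    using order_decomp[OF assms(2)] by blast
  define S where "S = {w. poly D1 w \<noteq> 0}"
  define h where "h w = poly N1 w / poly D1 w" for w
  define k where "k = int (order p N) - int (order p D)"
  have "open S" unfolding S_def
    by (intro open_Collect_neq continuous_intros)
  have "p \<in> S" using D1(2) by (simp add: S_def poly_eq_0_iff_dvd)
  have hp: "h p \<noteq> 0" using D1(2) N1(2) by (simp add: h_def poly_eq_0_iff_dvd)
  have holo: "h holomorphic_on S" unfolding h_def S_def by (intro holomorphic_intros) auto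
  have f_eq: "f w = h w * (w - p) powi k" if "w \<in> S" "w \<noteq> p" for w
  proof -
    have eqs: "poly N w = (w - p) ^ order p N * poly N1 w" "poly D w = (w - p) ^ order p D * poly D1 w"
      by (subst N1(1), simp, subst D1(1), simp)
    then have "poly D w \<noteq> 0" using that by (auto simp: S_def)
    then show ?thesis
      using that by (simp add: f eqs h_def k_def power_int_diff mult.commute)
  qed
  show "zorder f p = k"
    by (rule zorder_eqI[OF \<open>open S\<close> \<open>p \<in> S\<close> holo hp f_eq])
  assume "order p N < order p D"
  then obtain m where m: "k = - int m" "m > 0"
    by (intro that[of "order p D - order p N"]) (auto simp: k_def)
  have "is_pole (\<lambda>w. h w / (w - p) ^ m) p"
    by (rule is_pole_basic[OF holo \<open>open S\<close> \<open>p \<in> S\<close> hp m(2)])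
  moreover have "eventually (\<lambda>w. w \<in> S \<and> w \<noteq> p) (at p)"
    using \<open>open S\<close> \<open>p \<in> S\<close> by (auto simp: eventually_at_topological)
  then have "eventually (\<lambda>w. h w / (w - p) ^ m = f w) (at p)"
    by eventually_elim (simp add: f_eq m power_int_minus divide_inverse)
  ultimately show "is_pole f p" by (rule is_pole_transform) simp
qed

text \<open>Where the order of \<open>N\<close> falls short of that of \<open>D\<close> there is a
  pole. It is simple, so exactly one factor is missing, and the root of \<open>Q\<close> there
  supplies it.\<close>

lemma rational_simple_poles_clear:
  fixes N D Q :: "complex poly"
  assumes "D \<noteq> 0" "Q \<noteq> 0" and f: "\<And>z. poly D z \<noteq> 0 \<Longrightarrow> f z = poly N z / poly D z"
    and poles: "\<And>p. is_pole f p \<Longrightarrow> poly Q p = 0 \<and> zorder f p = - 1"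
  shows "D dvd N * Q"
proof (cases "N = 0")
  case False
  show ?thesis
  proof (rule dvd_if_order_le)
    fix p
    show "order p D \<le> order p (N * Q)"
    proof (cases "order p N < order p D")
      case True
      then have "is_pole f p" using zorder_rational(2)[OF False assms(1) f] by blast
      then have *: "poly Q p = 0" "zorder f p = - 1" using poles by auto
      then have "order p Q \<noteq> 0" using assms(2) by (simp add: order_root)
      with * zorder_rational(1)[OF False assms(1) f, of p] show ?thesis
        using False assms(2) by (simp add: order_mult)
    qed (use False assms(2) in \<open>simp add: order_mult\<close>)
  qed (use False assms in auto)
qed simp

text \<open>\<open>P(z)\<close> divided by \<open>z ^ degree P\<close> tends to the leading
  coefficient. A degree above \<open>k\<close> would make that limit 0, and a degree below
  \<open>k\<close> makes \<open>L\<close> equal to 0.\<close>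

lemma poly_div_power_tendsto:
  fixes P :: "complex poly"
  assumes lim: "((\<lambda>z. poly P z / z ^ k) \<longlongrightarrow> L) at_infinity"
  shows "degree P \<le> k" "coeff P k = L"
proof -
  have inv: "((\<lambda>z::complex. 1 / z ^ m) \<longlongrightarrow> 0) at_infinity" if "m > 0" for m
    by (rule tendsto_divide_0[OF tendsto_const]) (use that in \<open>auto intro!: filterlim_power_at_infinity filterlim_ident\<close>)
  have ev0: "eventually (\<lambda>z::complex. z \<noteq> 0) at_infinity"
    by (auto simp: eventually_at_infinity intro: exI[of _ 1])
  note lead = poly_divide_tendsto_aux[of P]
  show deg: "degree P \<le> k"
  proof (rule ccontr)
    assume "\<not> degree P \<le> k"
    then have m: "degree P - k > 0" by simp
    have "((\<lambda>z. poly P z / z ^ k * (1 / z ^ (degree P - k))) \<longlongrightarrow> L * 0) at_infinity"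
      by (intro tendsto_mult lim inv[OF m])
    moreover have "eventually (\<lambda>z. poly P z / z ^ k * (1 / z ^ (degree P - k)) = poly P z / z ^ degree P) at_infinity"
      using ev0 by eventually_elim (use m in \<open>simp add: power_add[symmetric]\<close>)
    ultimately have "((\<lambda>z. poly P z / z ^ degree P) \<longlongrightarrow> 0) at_infinity"
      unfolding mult_zero_right by (rule Lim_transform_eventually)
    then have "lead_coeff P = 0"
      using lead tendsto_unique[OF trivial_limit_at_infinity] by blast
    then show False using m by simp
  qed
  show "coeff P k = L"
  proof (cases "degree P = k")
    case True
    with lead lim show ?thesis using tendsto_unique[OF trivial_limit_at_infinity] by blast
  next
    case False
    with deg have m: "k - degree P > 0" "degree P < k" by auto
    have "((\<lambda>z. poly P z / z ^ degree P * (1 / z ^ (k - degree P))) \<longlongrightarrow> lead_coeff P * 0) at_infinity"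
      by (intro tendsto_mult lead inv m)
    moreover have "eventually (\<lambda>z. poly P z / z ^ degree P * (1 / z ^ (k - degree P)) = poly P z / z ^ k) at_infinity"
      using ev0 by eventually_elim (use m in \<open>simp add: power_add[symmetric]\<close>)
    ultimately have "((\<lambda>z. poly P z / z ^ k) \<longlongrightarrow> 0) at_infinity"
      unfolding mult_zero_right by (rule Lim_transform_eventually)
    then have "L = 0" using lim tendsto_unique[OF trivial_limit_at_infinity] by blast
    then show ?thesis using m by (simp add: coeff_eq_0)
  qed
qed

lemma poly_eq_if_eq_on_ball:
  fixes P Q :: "complex poly"
  assumes "0 < r" "\<And>z. z \<in> ball 0 r \<Longrightarrow> poly P z = poly Q z"
  shows "P = Q"
proof (rule ccontr)
  assume "P \<noteq> Q"
  then have "finite {z. poly (P - Q) z = 0}" by (intro poly_roots_finite) simp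
  moreover have "ball 0 r \<subseteq> {z. poly (P - Q) z = 0}" using assms(2) by auto
  ultimately have "finite (ball (0 :: complex) r)" by (rule finite_subset[rotated])
  then show False using uncountable_ball[OF assms(1), of "0 :: complex"] countable_finite by blast
qed

lemma eventually_poly_nonzero:
  fixes D :: "complex poly"
  assumes "D \<noteq> 0"
  shows "eventually (\<lambda>z. poly D z \<noteq> 0) at_infinity" "eventually (\<lambda>z. poly D z \<noteq> 0) (at p)"
proof -
  have fin: "finite {z. poly D z = 0}" by (rule poly_roots_finite[OF assms])
  then obtain B where "\<And>z. poly D z = 0 \<Longrightarrow> norm z \<le> B"
    using finite_imp_bounded bounded_iff by (metis (mono_tags) mem_Collect_eq)
  then show "eventually (\<lambda>z. poly D z \<noteq> 0) at_infinity"
    unfolding eventually_at_infinity by (intro exI[of _ "B + 1"]) force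
  have "\<forall>\<^sub>F z in at p. z \<notin> {z. poly D z = 0}"
    using islimpt_finite[OF fin] by (simp only: islimpt_iff_eventually not_not)
  then show "eventually (\<lambda>z. poly D z \<noteq> 0) (at p)" by simp
qed

text \<open>The factor \<open>z ^ 3 - c\<close> vanishes at every pole, so it cancels the whole
  denominator. The limit at infinity passes to \<open>P(z) / z ^ 3\<close>, which bounds the degree
  and gives the top coefficient.\<close>

lemma rational_cubic_numerator:
  fixes N D :: "complex poly"
  assumes D: "D \<noteq> 0" and f: "\<And>z. poly D z \<noteq> 0 \<Longrightarrow> f z = poly N z / poly D z"
    and poles: "\<And>p. is_pole f p \<Longrightarrow> p ^ 3 = c \<and> zorder f p = - 1"
    and lim: "(f \<longlongrightarrow> L) at_infinity"
  obtains P where "degree P \<le> 3" "coeff P 3 = L"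
    "\<And>z. poly D z \<noteq> 0 \<Longrightarrow> f z * (z ^ 3 - c) = poly P z"
proof -
  define Q where "Q = monom 1 3 - [:c:]"
  have Q: "poly Q z = z ^ 3 - c" for z by (simp add: Q_def poly_monom)
  have "coeff Q 3 = 1" by (simp add: Q_def numeral_3_eq_3)
  then have "Q \<noteq> 0" by auto
  then have "D dvd N * Q"
    using poles by (intro rational_simple_poles_clear[OF D _ f]) (auto simp: Q)
  then obtain P where P: "N * Q = D * P" by blast
  have fP: "f z * (z ^ 3 - c) = poly P z" if "poly D z \<noteq> 0" for z
  proof -
    have "poly N z * (z ^ 3 - c) = poly D z * poly P z" by (metis P Q poly_mult)
    then show ?thesis using that by (simp add: f field_simps)
  qed
  have "((\<lambda>z::complex. c / z ^ 3) \<longlongrightarrow> 0) at_infinity"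
    by (rule tendsto_divide_0[OF tendsto_const]) (auto intro!: filterlim_power_at_infinity filterlim_ident)
  then have "((\<lambda>z. f z * (1 - c / z ^ 3)) \<longlongrightarrow> L * (1 - 0)) at_infinity"
    by (intro tendsto_intros lim)
  moreover have "eventually (\<lambda>z::complex. z \<noteq> 0) at_infinity"
    by (auto simp: eventually_at_infinity intro: exI[of _ 1])
  with eventually_poly_nonzero(1)[OF D]
  have "eventually (\<lambda>z. f z * (1 - c / z ^ 3) = poly P z / z ^ 3) at_infinity"
    by eventually_elim (simp add: fP[symmetric] field_simps)
  ultimately have "((\<lambda>z. poly P z / z ^ 3) \<longlongrightarrow> L * (1 - 0)) at_infinity"
    by (rule Lim_transform_eventually)
  from poly_div_power_tendsto[OF this] show thesis
    using that[of P] fP by simp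
qed

section \<open>Continuity of loops and their polynomial numerators\<close>

lemma Lambda_minus_tendsto_infinity:
  assumes "0 < r" "f \<in> Lambda_minus r G"
  shows "((\<lambda>z. f z $ i $ j) \<longlongrightarrow> mat 1 $ i $ j) at_infinity"
proof -
  define h where "h w = (if w = 0 then mat 1 else f (1 / w)) $ i $ j" for w
  have "h holomorphic_on ball 0 r" using assms unfolding Lambda_minus_def h_def by blast
  then have "isCont h 0"
    using assms(1) by (meson centre_in_ball continuous_on_eq_continuous_at holomorphic_on_imp_continuous_on open_ball)
  then have "(h \<longlongrightarrow> mat 1 $ i $ j) (at 0)" by (simp add: isCont_def h_def)
  moreover have "eventually (\<lambda>w. h w = f (inverse w) $ i $ j) (at 0)"
    by (auto simp: eventually_at_filter h_def inverse_eq_divide)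
  ultimately have "((\<lambda>w. f (inverse w) $ i $ j) \<longlongrightarrow> mat 1 $ i $ j) (at 0)"
    by (rule Lim_transform_eventually)
  then show ?thesis by (subst lim_at_infinity_0) (simp add: o_def)
qed

lemma open_loop_domain: "open (loop_domain r)"
  unfolding loop_domain_def by (intro open_Collect_disj open_Collect_less continuous_intros)

text \<open>Inside the disc this is the holomorphy of \<open>f\<close> itself. In the outer region
  \<open>f\<close> is locally the chart function at infinity composed with inversion.\<close>

lemma Lambda_minus_isCont:
  assumes r: "0 < r" and f: "f \<in> Lambda_minus r G" and z: "z \<in> loop_domain r"
  shows "isCont (\<lambda>z. f z $ i $ j) z"
proof (cases "norm z < r")
  case True
  have "(\<lambda>z. f z $ i $ j) holomorphic_on ball 0 r" using f unfolding Lambda_minus_def by blast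
  moreover have "z \<in> ball 0 r" using True by simp
  ultimately show ?thesis
    by (meson continuous_on_eq_continuous_at holomorphic_on_imp_continuous_on open_ball)
next
  case False
  then have nz: "norm z > 1 / r" using z by (auto simp: loop_domain_def)
  then have z0: "z \<noteq> 0" using r by auto
  define h where "h w = (if w = 0 then mat 1 else f (1 / w)) $ i $ j" for w
  have "h holomorphic_on ball 0 r" using f unfolding Lambda_minus_def h_def by blast
  moreover have "1 / z \<in> ball 0 r" using nz r z0 by (simp add: norm_divide field_simps)
  ultimately have "isCont h (1 / z)"
    by (meson continuous_on_eq_continuous_at holomorphic_on_imp_continuous_on open_ball)
  then have "isCont (\<lambda>z. h (1 / z)) z"
    using z0 by (intro isCont_o2[of z "\<lambda>z. 1 / z" h] continuous_intros)
  moreover have "eventually (\<lambda>z. h (1 / z) = f z $ i $ j) (nhds z)"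
    using t1_space_nhds[OF z0] by eventually_elim (simp add: h_def)
  ultimately show ?thesis by (simp add: isCont_cong)
qed

text \<open>Replaces the rational continuation by polynomial identities for \<open>g\<close> on the
  loop domain. The pole at \<open>\<alpha>\<close> is used up here: it survives only in the last
  conclusion, which later rules out the identity as a solution.\<close>

lemma simplest_rational_numerator:
  assumes r: "0 < r" and g: "simplest_rational r g"
  obtains \<alpha> P where "\<alpha> \<noteq> 0"
    "\<And>i j. degree (P i j) \<le> 3" "\<And>i j. coeff (P i j) 3 = mat 1 $ i $ j"
    "\<And>z. z \<in> loop_domain r \<Longrightarrow> z ^ 3 \<noteq> \<alpha> ^ 3"
    "\<And>z i j. z \<in> loop_domain r \<Longrightarrow> g z $ i $ j * (z ^ 3 - \<alpha> ^ 3) = poly (P i j) z"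
    "\<not> (\<forall>z\<in>loop_domain r. g z = mat ((z ^ 3 + \<alpha> ^ 3) / (z ^ 3 - \<alpha> ^ 3)))"
    "\<not> (\<forall>z\<in>loop_domain r. g z = mat 1)"
proof -
  obtain R \<alpha> where R: "rational_matrix_fun R" and Rg: "\<And>z. z \<in> loop_domain r \<Longrightarrow> R z = g z"
    and \<alpha>: "\<alpha> \<noteq> 0" and poles: "{p. matrix_pole R p} = {\<alpha>, eps ^ 2 * \<alpha>, eps ^ 4 * \<alpha>}"
    and simple: "\<And>p. p \<in> {\<alpha>, eps ^ 2 * \<alpha>, eps ^ 4 * \<alpha>} \<Longrightarrow> matrix_simple_pole R p"
    and nontriv: "\<not> (\<forall>z\<in>loop_domain r. g z = mat ((z ^ 3 + \<alpha> ^ 3) / (z ^ 3 - \<alpha> ^ 3)))"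
    and g_in: "g \<in> Lambda_minus r GL3"
    using g unfolding simplest_rational_def Lambda_minus_sigma_def by blast
  obtain N D where D: "D \<noteq> 0" and N: "\<And>z i j. poly D z \<noteq> 0 \<Longrightarrow> R z $ i $ j = poly (N $ i $ j) z / poly D z"
    using R unfolding rational_matrix_fun_def by blast
  have eps6: "eps ^ 6 = 1" and eps12: "eps ^ 12 = 1"
    unfolding eps_def exp_of_nat_mult[symmetric]
    by (simp_all add: exp_eq_1 exI[of _ "1::int"] exI[of _ "2::int"])
  \<comment> \<open>The three poles share the cube \<open>\<alpha> ^ 3\<close>, so one factor
    \<open>z ^ 3 - \<alpha> ^ 3\<close> clears all of them.\<close>
  have pole_cube: "p ^ 3 = \<alpha> ^ 3 \<and> zorder (\<lambda>z. R z $ i $ j) p = - 1"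
    if "is_pole (\<lambda>z. R z $ i $ j) p" for i j p
  proof -
    have p: "p \<in> {\<alpha>, eps ^ 2 * \<alpha>, eps ^ 4 * \<alpha>}" using that poles by (auto simp: matrix_pole_def)
    then have "p ^ 3 = \<alpha> ^ 3" by (auto simp: power_mult_distrib power_mult[symmetric] eps6 eps12)
    moreover have "zorder (\<lambda>z. R z $ i $ j) p = - 1"
      using simple[OF p] that by (auto simp: matrix_simple_pole_def)
    ultimately show ?thesis ..
  qed
  have "eventually (\<lambda>z. z \<in> loop_domain r) at_infinity"
    unfolding eventually_at_infinity loop_domain_def by (intro exI[of _ "1 / r + 1"]) auto
  then have lim: "((\<lambda>z. R z $ i $ j) \<longlongrightarrow> mat 1 $ i $ j) at_infinity" for i j
    by (intro Lim_transform_eventually[OF Lambda_minus_tendsto_infinity[OF r g_in]])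
       (auto elim!: eventually_mono simp: Rg)
  have "\<exists>P. degree P \<le> 3 \<and> coeff P 3 = mat 1 $ i $ j \<and>
        (\<forall>z. poly D z \<noteq> 0 \<longrightarrow> R z $ i $ j * (z ^ 3 - \<alpha> ^ 3) = poly P z)" for i j
    by (rule rational_cubic_numerator[OF D N pole_cube lim]) blast+
  then obtain P where P: "\<And>i j. degree (P i j) \<le> 3" "\<And>i j. coeff (P i j) 3 = mat 1 $ i $ j"
    and RP: "\<And>i j z. poly D z \<noteq> 0 \<Longrightarrow> R z $ i $ j * (z ^ 3 - \<alpha> ^ 3) = poly (P i j) z"
    by metis
  have ev_loop: "eventually (\<lambda>w. w \<in> loop_domain r) (at z)" if "z \<in> loop_domain r" for z
    using open_loop_domain that by (metis eventually_at_topological)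
  \<comment> \<open>At zeros of \<open>D\<close> the value of \<open>R\<close> is unconstrained. The
    identity for \<open>g\<close> extends to such points by continuity from the punctured
    neighbourhood.\<close>
  have gP: "g z $ i $ j * (z ^ 3 - \<alpha> ^ 3) = poly (P i j) z" if z: "z \<in> loop_domain r" for z i j
  proof -
    have "isCont (\<lambda>z. g z $ i $ j * (z ^ 3 - \<alpha> ^ 3)) z"
      by (intro continuous_intros Lambda_minus_isCont[OF r g_in z])
    moreover have "eventually (\<lambda>w. g w $ i $ j * (w ^ 3 - \<alpha> ^ 3) = poly (P i j) w) (at z)"
      using ev_loop[OF z] eventually_poly_nonzero(2)[OF D] by eventually_elim (metis RP Rg)
    ultimately have "(poly (P i j) \<longlongrightarrow> g z $ i $ j * (z ^ 3 - \<alpha> ^ 3)) (at z)"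
      unfolding isCont_def by (rule Lim_transform_eventually)
    moreover have "(poly (P i j) \<longlongrightarrow> poly (P i j) z) (at z)"
      by (intro tendsto_intros)
    ultimately show ?thesis using LIM_unique by blast
  qed
  have "matrix_pole R \<alpha>" using poles by blast
  then obtain i j where pole: "is_pole (\<lambda>z. R z $ i $ j) \<alpha>" by (auto simp: matrix_pole_def)
  have "\<alpha> \<notin> loop_domain r"
  proof
    assume A: "\<alpha> \<in> loop_domain r"
    have "is_pole (\<lambda>z. g z $ i $ j) \<alpha>"
      by (rule is_pole_transform[OF pole]) (use ev_loop[OF A] Rg in \<open>auto elim: eventually_mono\<close>)
    moreover have "isCont (\<lambda>z. g z $ i $ j) \<alpha>" by (rule Lambda_minus_isCont[OF r g_in A])
    ultimately show False
      using not_tendsto_and_filterlim_at_infinity[OF at_neq_bot] by (auto simp: is_pole_def isCont_def)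
  qed
  \<comment> \<open>Membership in the loop domain depends only on the norm, so the exclusion of
    \<open>\<alpha>\<close> excludes all three cube roots of \<open>\<alpha> ^ 3\<close>.\<close>
  have cube: "z ^ 3 \<noteq> \<alpha> ^ 3" if "z \<in> loop_domain r" for z
  proof
    assume "z ^ 3 = \<alpha> ^ 3"
    then have "norm z ^ 3 = norm \<alpha> ^ 3" by (metis norm_power)
    then have "norm z = norm \<alpha>" by (simp add: power_eq_iff_eq_base)
    with that \<open>\<alpha> \<notin> loop_domain r\<close> show False by (simp add: loop_domain_def)
  qed
  have "\<not> (\<forall>z\<in>loop_domain r. g z = mat 1)"
  proof
    assume 1: "\<forall>z\<in>loop_domain r. g z = mat 1"
    \<comment> \<open>If \<open>g\<close> were the identity, its numerators would be scalar
      multiples of \<open>z ^ 3 - \<alpha> ^ 3\<close>, and the entry of \<open>R\<close> with a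
      pole would be constant near \<open>\<alpha>\<close>.\<close>
    have "P i j = smult (mat 1 $ i $ j) (monom 1 3 - [:\<alpha> ^ 3:])"
    proof (rule poly_eq_if_eq_on_ball[OF r])
      fix z assume "z \<in> ball (0 :: complex) r"
      then have z: "z \<in> loop_domain r" by (simp add: loop_domain_def)
      show "poly (P i j) z = poly (smult (mat 1 $ i $ j) (monom 1 3 - [:\<alpha> ^ 3:])) z"
        using gP[OF z, of i j] 1 z by (simp add: poly_monom)
    qed
    then have RI: "R z $ i $ j * (z ^ 3 - \<alpha> ^ 3) = mat 1 $ i $ j * (z ^ 3 - \<alpha> ^ 3)" if "poly D z \<noteq> 0" for z
      using RP[OF that] by (simp add: poly_monom)
    have "monom 1 3 - [:\<alpha> ^ 3:] \<noteq> 0"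
      by (metis coeff_diff coeff_monom coeff_0 coeff_pCons_0 numeral_3_eq_3 coeff_pCons_Suc diff_zero zero_neq_one)
    from eventually_poly_nonzero(2)[OF this] eventually_poly_nonzero(2)[OF D]
    have "eventually (\<lambda>z. R z $ i $ j = mat 1 $ i $ j) (at \<alpha>)"
      by eventually_elim (use RI in \<open>auto simp: poly_monom\<close>)
    then have "is_pole (\<lambda>z. mat 1 $ i $ j :: complex) \<alpha>" by (rule is_pole_transform[OF pole]) simp
    then show False
      using not_tendsto_and_filterlim_at_infinity[OF at_neq_bot tendsto_const] by (auto simp: is_pole_def)
  qed
  then show thesis using that[OF \<alpha> P cube gP nontriv] by blast
qed

section \<open>The \<open>\<sigma>\<close> condition\<close>

text \<open>The cyclotomic relation of a primitive sixth root of unity, checked on real and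
  imaginary parts.\<close>

lemma eps_square: "eps ^ 2 = eps - 1"
proof -
  have *: "eps = cis (pi / 3)" by (simp add: eps_def cis_conv_exp mult.commute)
  have parts: "Re eps = 1 / 2" "Im eps = sqrt 3 / 2" unfolding * by (simp_all add: cos_60 sin_60)
  show ?thesis by (simp add: complex_eq_iff Re_power2 Im_power2 parts power_divide)
qed

lemma eps_cube: "eps ^ 3 = - 1"
proof -
  have "eps ^ 3 = eps * eps ^ 2" by (simp add: power3_eq_cube power2_eq_square)
  also have "\<dots> = - 1" unfolding eps_square by (simp add: right_diff_distrib power2_eq_square[symmetric] eps_square)
  finally show ?thesis .
qed

lemma eps_nonzero: "eps \<noteq> 0"
  by (simp add: eps_def)

lemma norm_eps: "norm eps = 1"
  by (simp add: eps_def)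

lemma matrix_inv_left: "invertible A \<Longrightarrow> matrix_inv A ** A = mat 1" for A :: "'a :: semiring_1 ^ 'n ^ 'm"
  unfolding invertible_def matrix_inv_def by (rule someI2_ex) auto

lemma invertible_Tmat: "invertible Tmat"
  by (simp add: invertible_det_nz det_3 Tmat_def eps_nonzero)

text \<open>Both inverses in \<open>sigma\<close> cancel, so the symmetry condition becomes a
  bilinear relation without inverses, suited to comparing coefficients.\<close>

lemma sigma_mult_transpose:
  assumes "invertible A"
  shows "sigma A ** Tmat ** transpose A = Tmat"
proof -
  have "invertible (transpose A)" using assms by (simp add: invertible_det_nz)
  then have "matrix_inv (transpose A) ** transpose A = mat 1" by (rule matrix_inv_left)
  moreover have "matrix_inv Tmat ** Tmat = mat 1" by (rule matrix_inv_left[OF invertible_Tmat])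
  ultimately show ?thesis unfolding sigma_def by (metis matrix_mul_assoc matrix_mul_rid)
qed

lemma eps_mult_loop_domain: "z \<in> loop_domain r \<Longrightarrow> eps * z \<in> loop_domain r"
  by (simp add: loop_domain_def norm_mult norm_eps)

text \<open>The square of \<open>\<sigma>\<close> is conjugation by \<open>T T\<^sup>-\<^sup>t = diag(\<epsilon>\<^sup>2, \<epsilon>\<^sup>4, 1)\<close>, which is \<open>Q\<^sup>-\<^sup>1\<close>.\<close>

definition Smat :: cmat3 where
  "Smat = vector [vector [eps ^ 2, 0, 0], vector [0, - eps, 0], vector [0, 0, 1]]"

lemma Smat_mult_transpose_Tmat: "Smat ** transpose Tmat = Tmat"
proof -
  have "eps ^ 2 * eps = - 1" using eps_cube by (simp add: power3_eq_cube power2_eq_square)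
  then show ?thesis
    by (simp add: vec_eq_iff forall_3 matrix_matrix_mult_def sum_3 transpose_def Tmat_def Smat_def)
qed

lemma
  assumes g: "g \<in> Lambda_minus_sigma r GL3" and z: "z \<in> loop_domain r"
  shows Lambda_minus_sigma_bilinear: "g (eps * z) ** Tmat ** transpose (g z) = Tmat"
    and Lambda_minus_sigma_grading: "g (eps ^ 2 * z) ** Smat = Smat ** g z"
proof -
  have inv: "invertible (g w)" if "w \<in> loop_domain r" for w
    using g that by (auto simp: Lambda_minus_sigma_def Lambda_minus_def GL3_def)
  have bil: "g (eps * w) ** Tmat ** transpose (g w) = Tmat" if "w \<in> loop_domain r" for w
    using g that sigma_mult_transpose[OF inv[OF that]] by (simp add: Lambda_minus_sigma_def)
  show "g (eps * z) ** Tmat ** transpose (g z) = Tmat" by (rule bil[OF z])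
  \<comment> \<open>The relations at \<open>z\<close> (transposed) and at \<open>eps * z\<close>
    share this invertible right factor. With \<open>Smat ** transpose Tmat = Tmat\<close>, both
    sides of the grading times \<open>X\<close> equal \<open>Tmat\<close>, and \<open>X\<close>
    cancels.\<close>
  define X where "X = transpose Tmat ** transpose (g (eps * z))"
  have "invertible X"
    unfolding X_def using inv[OF eps_mult_loop_domain[OF z]] invertible_Tmat
    by (simp add: invertible_det_nz det_mul)
  have "transpose (g (eps * z) ** Tmat ** transpose (g z)) = transpose Tmat" using bil[OF z] by simp
  then have 1: "g z ** X = transpose Tmat"
    by (simp add: matrix_transpose_mul transpose_transpose matrix_mul_assoc X_def)
  have "g (eps ^ 2 * z) ** Tmat ** transpose (g (eps * z)) = Tmat"
    using bil[OF eps_mult_loop_domain[OF z]] by (simp add: power2_eq_square mult.assoc)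
  then have 2: "g (eps ^ 2 * z) ** Smat ** X = Tmat"
    unfolding X_def by (metis Smat_mult_transpose_Tmat matrix_mul_assoc)
  have "g (eps ^ 2 * z) ** Smat ** X = Smat ** g z ** X"
    unfolding 2 by (metis 1 Smat_mult_transpose_Tmat matrix_mul_assoc)
  then show "g (eps ^ 2 * z) ** Smat = Smat ** g z"
    using \<open>invertible X\<close> by (metis invertible_def matrix_mul_assoc matrix_mul_rid)
qed

text \<open>Evaluation at \<open>w\<close> and \<open>2 * w\<close> suffices: the cubes differ by
  the factor 8, so subtraction isolates \<open>7 * b * w ^ 3\<close>. The choice
  \<open>r / 4\<close> keeps both points inside the disc.\<close>

lemma cubic_vanishing_coeffs:
  fixes a b :: complex
  assumes "0 < r" "\<And>z. z \<noteq> 0 \<Longrightarrow> norm z < r \<Longrightarrow> a + b * z ^ 3 = 0"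
  shows "a = 0" "b = 0"
proof -
  define w :: complex where "w = of_real (r / 4)"
  have "w \<noteq> 0" using assms(1) by (simp add: w_def)
  have 1: "a + b * w ^ 3 = 0" using assms(1) by (intro assms(2)) (auto simp: w_def)
  have 2: "a + b * (2 * w) ^ 3 = 0" using assms(1) by (intro assms(2)) (auto simp: w_def norm_mult)
  have "7 * w ^ 3 \<noteq> 0" using \<open>w \<noteq> 0\<close> by simp
  have "b * (7 * w ^ 3) = (a + b * (2 * w) ^ 3) - (a + b * w ^ 3)"
    by (simp add: power_mult_distrib algebra_simps)
  then show "b = 0" unfolding 1 2 using \<open>7 * w ^ 3 \<noteq> 0\<close> by (metis diff_zero mult_eq_0_iff)
  with 1 show "a = 0" by simp
qed

section \<open>Grading of the numerator by exponents modulo 3\<close>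

lemma poly_degree_le_3:
  fixes P :: "'a :: comm_semiring_1 poly"
  assumes "degree P \<le> 3"
  shows "poly P z = coeff P 0 + coeff P 1 * z + coeff P 2 * z ^ 2 + coeff P 3 * z ^ 3"
proof -
  have "poly P z = (\<Sum>i\<le>3. coeff P i * z ^ i)"
    unfolding poly_altdef by (rule sum.mono_neutral_left[OF finite_atMost]) (use assms in \<open>auto simp: atMost_def coeff_eq_0\<close>)
  then show ?thesis by (simp add: numeral_3_eq_3 numeral_2_eq_2)
qed

lemma eps_powers:
  "eps ^ 4 = - eps" "eps ^ 6 = 1" "eps ^ 2 * eps = - 1" "eps * eps ^ 2 = - 1"
  "eps ^ 2 * eps ^ 2 = - eps" "eps * eps ^ 4 = - (eps ^ 2)" "eps ^ 2 * eps ^ 4 = 1"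
proof -
  show 1: "eps ^ 2 * eps = - 1" and "eps * eps ^ 2 = - 1"
    using eps_cube by (simp_all add: power3_eq_cube power2_eq_square mult.assoc)
  have "eps ^ 4 = eps ^ 3 * eps" by (simp add: power_Suc2[symmetric])
  then show 4: "eps ^ 4 = - eps" by (simp add: eps_cube)
  have "eps ^ 6 = (eps ^ 3) ^ 2" by (simp add: power_mult[symmetric])
  then show "eps ^ 6 = 1" by (simp add: eps_cube)
  show "eps ^ 2 * eps ^ 2 = - eps" using 4 by (simp add: power_add[symmetric])
  show "eps * eps ^ 4 = - (eps ^ 2)" unfolding 4 by (simp add: power2_eq_square)
  show "eps ^ 2 * eps ^ 4 = 1" unfolding 4 by (simp add: 1)
qed

text \<open>\<open>1\<close>, \<open>eps ^ 2\<close> and \<open>- eps\<close> are the three cube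
  roots of unity and the diagonal of \<open>Smat\<close>. Their distinctness is what separates the
  residue classes of exponents.\<close>

lemma eps_distinct: "eps ^ 2 \<noteq> 1" "eps ^ 2 \<noteq> - eps" "- eps \<noteq> 1"
proof -
  show "- eps \<noteq> 1"
  proof
    assume "- eps = 1"
    then have "eps = - 1" by (metis add.inverse_inverse)
    with eps_square have "(- 1) ^ 2 = (- 1 :: complex) - 1" by metis
    then show False by simp
  qed
  show "eps ^ 2 \<noteq> 1"
  proof
    assume "eps ^ 2 = 1"
    then have "eps = 2" using eps_square by (simp add: algebra_simps)
    with eps_cube have "(2 :: complex) ^ 3 = - 1" by metis
    then show False by simp
  qed
  show "eps ^ 2 \<noteq> - eps"
  proof
    assume "eps ^ 2 = - eps"
    then have "eps * (eps + 1) = 0" by (simp add: power2_eq_square algebra_simps)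
    with eps_nonzero \<open>- eps \<noteq> 1\<close> show False by (metis add.commute minus_unique mult_eq_0_iff)
  qed
qed

text \<open>The substitution of \<open>w * z\<close> for \<open>z\<close> multiplies the
  \<open>k\<close>-th coefficient by \<open>w ^ k\<close>, so that coefficient is annihilated by
  \<open>s * w ^ k - s'\<close>.\<close>

lemma coeff_zero_if_graded:
  fixes P :: "complex poly"
  assumes "0 < r" and eq: "\<And>z. z \<in> ball 0 r \<Longrightarrow> poly P (w * z) * s = s' * poly P z"
    and "s * w ^ k \<noteq> s'"
  shows "coeff P k = 0"
proof -
  have "smult s (pcompose P [:0, w:]) = smult s' P"
    by (rule poly_eq_if_eq_on_ball[OF assms(1)]) (use eq in \<open>simp add: poly_pcompose mult.commute\<close>)
  from arg_cong[OF this, of "\<lambda>p. coeff p k"] have "(s * w ^ k - s') * coeff P k = 0"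
    by (simp add: coeff_pcompose_linear algebra_simps)
  with assms(3) show ?thesis by simp
qed

text \<open>A coefficient of \<open>z ^ k\<close> in entry \<open>(i, j)\<close> survives only if
  \<open>Smat $ j $ j * eps ^ (2 * k) = Smat $ i $ i\<close>, which fixes \<open>k\<close> modulo 3:
  0 on the diagonal, 1 or 2 off it.\<close>

lemma numerator_graded_form:
  fixes P :: "3 \<Rightarrow> 3 \<Rightarrow> complex poly"
  assumes r: "0 < r" and deg: "\<And>i j. degree (P i j) \<le> 3"
    and lead: "\<And>i j. coeff (P i j) 3 = mat 1 $ i $ j"
    and grading: "\<forall>z\<in>ball 0 r. \<forall>i j.
      poly (P i j) (eps ^ 2 * z) * Smat $ j $ j = Smat $ i $ i * poly (P i j) z"
  shows "\<exists>p x y u q v w t s. \<forall>z.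
    poly (P 1 1) z = z ^ 3 + p \<and> poly (P 1 2) z = x * z ^ 2 \<and> poly (P 1 3) z = y * z \<and>
    poly (P 2 1) z = u * z \<and> poly (P 2 2) z = z ^ 3 + q \<and> poly (P 2 3) z = v * z ^ 2 \<and>
    poly (P 3 1) z = w * z ^ 2 \<and> poly (P 3 2) z = t * z \<and> poly (P 3 3) z = z ^ 3 + s"
proof -
  have S: "Smat $ 1 $ 1 = eps ^ 2" "Smat $ 2 $ 2 = - eps" "Smat $ 3 $ 3 = 1"
    by (simp_all add: Smat_def)
  have zero: "coeff (P i j) k = 0" if "Smat $ j $ j * (eps ^ 2) ^ k \<noteq> Smat $ i $ i" for i j k
    using grading that by (intro coeff_zero_if_graded[OF r]) blast+
  note distinct = eps_distinct eps_distinct[symmetric]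
  have "coeff (P 1 1) 1 = 0" "coeff (P 1 1) 2 = 0" "coeff (P 2 2) 1 = 0" "coeff (P 2 2) 2 = 0"
    "coeff (P 3 3) 1 = 0" "coeff (P 3 3) 2 = 0" "coeff (P 1 2) 0 = 0" "coeff (P 1 2) 1 = 0"
    "coeff (P 1 3) 0 = 0" "coeff (P 1 3) 2 = 0" "coeff (P 2 1) 0 = 0" "coeff (P 2 1) 2 = 0"
    "coeff (P 2 3) 0 = 0" "coeff (P 2 3) 1 = 0" "coeff (P 3 1) 0 = 0" "coeff (P 3 1) 1 = 0"
    "coeff (P 3 2) 0 = 0" "coeff (P 3 2) 2 = 0"
    by (rule zero, use distinct in \<open>simp add: S eps_powers power_mult[symmetric] power2_eq_square[symmetric]\<close>)+
  moreover have "coeff (P i j) 3 = (if i = j then 1 else 0)" for i j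
    by (simp add: lead mat_def)
  ultimately show ?thesis
    by - (rule exI[of _ "coeff (P 1 1) 0"], rule exI[of _ "coeff (P 1 2) 2"], rule exI[of _ "coeff (P 1 3) 1"],
        rule exI[of _ "coeff (P 2 1) 1"], rule exI[of _ "coeff (P 2 2) 0"], rule exI[of _ "coeff (P 2 3) 2"],
        rule exI[of _ "coeff (P 3 1) 2"], rule exI[of _ "coeff (P 3 2) 1"], rule exI[of _ "coeff (P 3 3) 0"],
        simp add: poly_degree_le_3[OF deg])
qed

section \<open>Solving for the coefficients\<close>

text \<open>\<open>B\<close> is the bilinear form with matrix \<open>Tmat\<close>, applied to a row
  of the numerator at \<open>eps * z\<close> and a row at \<open>z\<close>. The sign in
  \<open>p - z ^ 3\<close> comes from \<open>eps ^ 3 = - 1\<close>. The conclusions are the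
  coefficients of the resulting polynomials in \<open>z\<close>.\<close>

lemma bilinear_parameters:
  fixes c :: complex
  defines "B \<equiv> \<lambda>(a1, a2, a3) (b1, b2, b3). a1 * b2 - eps * a2 * b1 + eps ^ 2 * a3 * b3"
  assumes r: "0 < r"
    and 11: "\<forall>z. norm z < r \<longrightarrow> B (p - z ^ 3, x * (eps * z) ^ 2, y * (eps * z)) (z ^ 3 + p, x * z ^ 2, y * z) = 0"
    and 12: "\<forall>z. norm z < r \<longrightarrow> B (p - z ^ 3, x * (eps * z) ^ 2, y * (eps * z)) (u * z, z ^ 3 + q, v * z ^ 2) = c ^ 2 - z ^ 6"
    and 13: "\<forall>z. norm z < r \<longrightarrow> B (p - z ^ 3, x * (eps * z) ^ 2, y * (eps * z)) (w * z ^ 2, t * z, z ^ 3 + s) = 0"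
    and 22: "\<forall>z. norm z < r \<longrightarrow> B (u * (eps * z), q - z ^ 3, v * (eps * z) ^ 2) (u * z, z ^ 3 + q, v * z ^ 2) = 0"
    and 23: "\<forall>z. norm z < r \<longrightarrow> B (u * (eps * z), q - z ^ 3, v * (eps * z) ^ 2) (w * z ^ 2, t * z, z ^ 3 + s) = 0"
    and 33: "\<forall>z. norm z < r \<longrightarrow> B (w * (eps * z) ^ 2, t * (eps * z), s - z ^ 3) (w * z ^ 2, t * z, z ^ 3 + s) = eps ^ 2 * (c ^ 2 - z ^ 6)"
  shows "2 * p * x = y ^ 2" "p * q = c ^ 2" "p - q + x * u - y * v = 0" "p * t = y * s" "t + y = x * w"
    "2 * u = v ^ 2" "w = v" "u * t = q * w + v * s" "s ^ 2 = c ^ 2"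
proof -
  define e where "e = eps"
  have e3: "e ^ 3 = - 1" and e0: "e \<noteq> 0" using eps_cube eps_nonzero by (simp_all add: e_def)
  note B = B_def case_prod_conv e_def[symmetric]
  show "s ^ 2 = c ^ 2"
    using 33[rule_format, of 0] r e0 by (simp add: B power2_eq_square)
  show pq: "p * q = c ^ 2"
    using 12[rule_format, of 0] r by (simp add: B)
  \<comment> \<open>The terms in \<open>z ^ 5\<close> cancel because \<open>eps ^ 3 = - 1\<close>,
    leaving one multiple of \<open>z ^ 2\<close>. The zero cubic coefficient fits the shape of
    \<open>cubic_vanishing_coeffs\<close>; the other entries are treated alike after removing their
    common power of \<open>z\<close>.\<close>
  have "(2 * p * x - y ^ 2) + 0 * z ^ 3 = 0" if "z \<noteq> 0" "norm z < r" for z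
  proof -
    have "(2 * p * x - y ^ 2) * z ^ 2 = 0" using 11[rule_format, OF that(2)] e3 unfolding B by algebra
    then show ?thesis using that by simp
  qed
  from cubic_vanishing_coeffs(1)[OF r this] show "2 * p * x = y ^ 2" by simp
  have "0 + (p - q + x * u - y * v) * z ^ 3 = 0" if "z \<noteq> 0" "norm z < r" for z
    using 12[rule_format, OF that(2)] e3 pq unfolding B by algebra
  from cubic_vanishing_coeffs(2)[OF r this] show "p - q + x * u - y * v = 0" by simp
  have coeffs13: "(p * t - y * s) + (x * w - t - y) * z ^ 3 = 0" if "z \<noteq> 0" "norm z < r" for z
  proof -
    have "((p * t - y * s) + (x * w - t - y) * z ^ 3) * z = 0"
      using 13[rule_format, OF that(2)] e3 unfolding B by algebra
    then show ?thesis using that by simp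
  qed
  from cubic_vanishing_coeffs[OF r coeffs13] show "p * t = y * s" "t + y = x * w" by (auto simp: algebra_simps)
  have coeffs22: "0 + e * (2 * u - v ^ 2) * z ^ 3 = 0" if "z \<noteq> 0" "norm z < r" for z
  proof -
    have "(e * (2 * u - v ^ 2) * z ^ 3) * z = 0"
      using 22[rule_format, OF that(2)] e3 unfolding B by algebra
    then show ?thesis using that by simp
  qed
  from cubic_vanishing_coeffs(2)[OF r coeffs22] show "2 * u = v ^ 2" using e0 by simp
  have coeffs23: "(u * t - q * w - v * s) + (w - v) * z ^ 3 = 0" if "z \<noteq> 0" "norm z < r" for z
  proof -
    have "e * ((u * t - q * w - v * s) + (w - v) * z ^ 3) * z ^ 2 = 0"
      using 23[rule_format, OF that(2)] e3 unfolding B by algebra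
    then show ?thesis using that e0 by simp
  qed
  from cubic_vanishing_coeffs[OF r coeffs23] show "w = v" "u * t = q * w + v * s"
    by (auto simp: algebra_simps)
qed

text \<open>The sign \<open>\<delta>\<close> separates the two types, and \<open>a\<close>,
  \<open>b\<close> are normalised from the coefficients \<open>v\<close> and \<open>t\<close>. With
  \<open>d = 2 * a * b - 1\<close> and \<open>p = \<delta> * \<alpha> ^ 3 * m\<close>, the system
  yields \<open>(m * d) ^ 2 = 1\<close> and \<open>b * (m * d - 1) = 0\<close>, so
  \<open>m = 1 / d\<close> apart from one scalar solution.\<close>

lemma bilinear_parameters_solution:
  fixes \<alpha> :: complex
  assumes \<alpha>: "\<alpha> \<noteq> 0"
    and eqs: "2 * p * x = y ^ 2" "p * q = (\<alpha> ^ 3) ^ 2" "p - q + x * u - y * v = 0" "p * t = y * s"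
      "t + y = x * v" "2 * u = v ^ 2" "u * t = q * v + v * s"
    and s: "s = \<delta> * \<alpha> ^ 3" "\<delta> ^ 2 = 1"
    and nontriv: "\<not> (p = s \<and> q = s \<and> x = 0 \<and> y = 0 \<and> u = 0 \<and> v = 0 \<and> t = 0)"
  defines "a \<equiv> \<delta> * v / (2 * \<alpha>)" and "b \<equiv> t / (2 * \<alpha> ^ 2)"
  shows "2 * a * b \<noteq> 1" "v = \<delta> * 2 * \<alpha> * a" "t = 2 * \<alpha> ^ 2 * b" "u = 2 * \<alpha> ^ 2 * a ^ 2"
    "p = \<delta> * \<alpha> ^ 3 / (2 * a * b - 1)" "q = \<delta> * \<alpha> ^ 3 * (2 * a * b - 1)"
    "x = \<delta> * 2 * \<alpha> * b ^ 2 / (2 * a * b - 1)" "y = 2 * \<alpha> ^ 2 * b / (2 * a * b - 1)"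
proof -
  have \<delta>: "\<delta> * \<delta> = 1" "\<delta> \<noteq> 0" using s(2) by (auto simp: power2_eq_square)
  define d where "d = 2 * a * b - 1"
  show v: "v = \<delta> * 2 * \<alpha> * a" using \<alpha> \<delta> by (simp add: a_def mult.assoc[symmetric])
  show t: "t = 2 * \<alpha> ^ 2 * b" using \<alpha> by (simp add: b_def)
  have "2 * u = 2 * (2 * \<alpha> ^ 2 * a ^ 2)" using eqs(6) s(2) v by algebra
  then show u: "u = 2 * \<alpha> ^ 2 * a ^ 2" by simp
  define k where "k = \<alpha> ^ 3"
  have k: "k \<noteq> 0" using \<alpha> by (simp add: k_def)
  have "p \<noteq> 0" using eqs(2) \<alpha> by auto
  define m where "m = p / (\<delta> * k)"
  have p: "p = \<delta> * k * m" using k \<delta> by (simp add: m_def)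
  have "m \<noteq> 0" using \<open>p \<noteq> 0\<close> p by auto
  have "\<delta> * k * (m * q) = \<delta> * k * (\<delta> * k)" using eqs(2) s(2) p by (simp add: k_def power2_eq_square mult_ac)
  then have q: "m * q = \<delta> * k" using k \<delta> by simp
  have "\<delta> * k * y = \<delta> * k * (m * t)" using eqs(4) p s(1) by (auto simp: k_def mult_ac)
  then have y: "y = m * t" using k \<delta> by simp
  have "\<delta> * k * m * 2 * x = \<delta> * k * m * (\<delta> * 4 * \<alpha> * b ^ 2 * m)"
    using eqs(1) y p t s(2) k_def by algebra
  then have x: "x = \<delta> * 2 * \<alpha> * b ^ 2 * m" using k \<delta> \<open>m \<noteq> 0\<close> by simp
  have "\<delta> * k * ((m * d) ^ 2 - 1) = 0"
    using eqs(3) x y u v t p q s(2) k_def unfolding d_def by algebra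
  then have sq: "(m * d) ^ 2 = 1" using k \<delta> by simp
  have "2 * \<alpha> ^ 2 * (b * (m * d - 1)) = 0"
    using eqs(5) x y v t s(2) unfolding d_def by algebra
  then have bd: "b * (m * d - 1) = 0" using \<alpha> by simp
  \<comment> \<open>Otherwise \<open>b = 0\<close>, hence \<open>d = - 1\<close> and
    \<open>m = 1\<close>. Then \<open>p = q = s\<close>, and \<open>(q + s) * v = 0\<close> with
    \<open>s\<close> nonzero forces \<open>v = 0\<close>: this is the excluded scalar
    solution.\<close>
  have "m * d = 1"
  proof (rule ccontr)
    assume "m * d \<noteq> 1"
    then have b: "b = 0" and "m * d = - 1" using bd sq by (auto simp: power2_eq_1_iff)
    then have m: "m = 1" by (simp add: d_def)
    then have "q = s" "p = s" using p q s(1) by (simp_all add: k_def)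
    moreover have "x = 0" "y = 0" "t = 0" using b x y t by simp_all
    moreover have "v = 0" using eqs(7) \<open>t = 0\<close> \<open>q = s\<close> s(1) \<delta> \<alpha> by auto
    moreover have "u = 0" using eqs(6) \<open>v = 0\<close> by simp
    ultimately show False using nontriv by blast
  qed
  then have d: "d \<noteq> 0" "m = 1 / d" by (auto simp: eq_divide_eq)
  from d(1) show "2 * a * b \<noteq> 1" by (simp add: d_def)
  show "p = \<delta> * \<alpha> ^ 3 / (2 * a * b - 1)" "q = \<delta> * \<alpha> ^ 3 * (2 * a * b - 1)"
    "x = \<delta> * 2 * \<alpha> * b ^ 2 / (2 * a * b - 1)" "y = 2 * \<alpha> ^ 2 * b / (2 * a * b - 1)"
    unfolding d_def[symmetric] k_def[symmetric] using p q x y t d by (simp_all add: field_simps)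
qed

section \<open>The two families over their common denominator, and the classification\<close>

lemma g_loop_entries:
  assumes "z ^ 3 \<noteq> \<alpha> ^ 3" "2 * a * b \<noteq> 1"
  shows "g_loop \<alpha> a b z = map_matrix (\<lambda>x. x / (z ^ 3 - \<alpha> ^ 3)) (vector
    [vector [z ^ 3 + \<alpha> ^ 3 / (2 * a * b - 1), 2 * \<alpha> * b ^ 2 / (2 * a * b - 1) * z ^ 2,
             2 * \<alpha> ^ 2 * b / (2 * a * b - 1) * z],
     vector [2 * \<alpha> ^ 2 * a ^ 2 * z, z ^ 3 + \<alpha> ^ 3 * (2 * a * b - 1), 2 * \<alpha> * a * z ^ 2],
     vector [2 * \<alpha> * a * z ^ 2, 2 * \<alpha> ^ 2 * b * z, z ^ 3 + \<alpha> ^ 3]])"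
proof -
  define d where "d = 2 * a * b - 1"
  define w where "w = z ^ 3 - \<alpha> ^ 3"
  have nz: "d \<noteq> 0" "w \<noteq> 0" using assms by (auto simp: d_def w_def)
  \<comment> \<open>The identity matrix is absorbed into the diagonal entries through
    \<open>2 * a * b = d + 1\<close>.\<close>
  have *: "1 + 2 / w * (\<alpha> ^ 3 * a * b / d) = (z ^ 3 + \<alpha> ^ 3 / d) / w"
    "1 + 2 / w * (\<alpha> ^ 3 * a * b) = (z ^ 3 + \<alpha> ^ 3 * d) / w"
    "1 + 2 / w * \<alpha> ^ 3 = (z ^ 3 + \<alpha> ^ 3) / w"
    using nz by (simp_all add: divide_simps) (simp_all add: d_def w_def algebra_simps)
  show ?thesis
    unfolding g_loop_def d_def[symmetric] w_def[symmetric]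
    using * by (simp add: vec_eq_iff forall_3 mat_def map_matrix_def mult_ac)
qed

text \<open>These are the numerators of \<open>g_loop_entries\<close> with the signs of the constant
  and \<open>z ^ 2\<close> terms reversed, which is the effect of
  \<open>\<delta> = - 1\<close>.\<close>

lemma h_loop_entries:
  assumes "z ^ 3 \<noteq> \<alpha> ^ 3" "2 * a * b \<noteq> 1"
  shows "h_loop \<alpha> a b z = map_matrix (\<lambda>x. x / (z ^ 3 - \<alpha> ^ 3)) (vector
    [vector [z ^ 3 - \<alpha> ^ 3 / (2 * a * b - 1), - (2 * \<alpha> * b ^ 2 / (2 * a * b - 1) * z ^ 2),
             2 * \<alpha> ^ 2 * b / (2 * a * b - 1) * z],
     vector [2 * \<alpha> ^ 2 * a ^ 2 * z, z ^ 3 - \<alpha> ^ 3 * (2 * a * b - 1), - (2 * \<alpha> * a * z ^ 2)],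
     vector [- (2 * \<alpha> * a * z ^ 2), 2 * \<alpha> ^ 2 * b * z, z ^ 3 - \<alpha> ^ 3]])"
proof -
  define d where "d = 2 * a * b - 1"
  define w where "w = z ^ 3 - \<alpha> ^ 3"
  have nz: "d \<noteq> 0" "w \<noteq> 0" using assms by (auto simp: d_def w_def)
  have *: "1 + 2 / w * (\<alpha> ^ 3 * (a * b - 1) / d) = (z ^ 3 - \<alpha> ^ 3 / d) / w"
    "1 + 2 / w * (\<alpha> ^ 3 * (1 - a * b)) = (z ^ 3 - \<alpha> ^ 3 * d) / w"
    using nz by (simp_all add: divide_simps) (simp_all add: d_def w_def algebra_simps)
  show ?thesis
    unfolding h_loop_def d_def[symmetric] w_def[symmetric]
    using * nz by (simp add: vec_eq_iff forall_3 mat_def map_matrix_def mult_ac)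
qed

theorem theorem4p3:
  fixes r :: real and g :: "complex \<Rightarrow> complex^3^3"
  assumes "0 < r" and "r < 1"
    and "simplest_rational r g"
  shows "\<exists>\<alpha> a b. \<alpha> \<noteq> 0 \<and> \<not> line a b \<subseteq> Delta \<and>
           ((\<forall>z\<in>loop_domain r. g z = g_loop \<alpha> a b z) \<or>
            (\<forall>z\<in>loop_domain r. g z = h_loop \<alpha> a b z))"
proof -
  obtain \<alpha> P where \<alpha>: "\<alpha> \<noteq> 0"
    and deg: "\<And>i j. degree (P i j) \<le> 3" and lead: "\<And>i j. coeff (P i j) 3 = mat 1 $ i $ j"
    and cube: "\<And>z. z \<in> loop_domain r \<Longrightarrow> z ^ 3 \<noteq> \<alpha> ^ 3"
    and gP: "\<And>z i j. z \<in> loop_domain r \<Longrightarrow> g z $ i $ j * (z ^ 3 - \<alpha> ^ 3) = poly (P i j) z"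
    and not_scalar: "\<not> (\<forall>z\<in>loop_domain r. g z = mat ((z ^ 3 + \<alpha> ^ 3) / (z ^ 3 - \<alpha> ^ 3)))"
    and not_id: "\<not> (\<forall>z\<in>loop_domain r. g z = mat 1)"
    by (rule simplest_rational_numerator[OF assms(1,3)]) blast
  have g: "g \<in> Lambda_minus_sigma r GL3" using assms(3) by (simp add: simplest_rational_def)
  define c where "c = \<alpha> ^ 3"
  have ball: "z \<in> loop_domain r" if "norm z < r" for z using that by (simp add: loop_domain_def)
  have grading: "\<forall>z\<in>ball 0 r. \<forall>i j.
      poly (P i j) (eps ^ 2 * z) * Smat $ j $ j = Smat $ i $ i * poly (P i j) z"
  proof (intro ballI allI)
    fix z i j assume "z \<in> ball (0 :: complex) r"
    then have z: "z \<in> loop_domain r" "eps ^ 2 * z \<in> loop_domain r"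
      by (auto intro!: ball simp: norm_mult norm_power norm_eps)
    have "(g (eps ^ 2 * z) ** Smat) $ i $ j = (Smat ** g z) $ i $ j"
      using Lambda_minus_sigma_grading[OF g z(1)] by simp
    then have "g (eps ^ 2 * z) $ i $ j * Smat $ j $ j = Smat $ i $ i * g z $ i $ j"
      using exhaust_3[of i] exhaust_3[of j]
      by (auto simp: matrix_matrix_mult_def sum_3 Smat_def)
    moreover have "(eps ^ 2 * z) ^ 3 = z ^ 3"
      by (simp add: power_mult_distrib power_mult[symmetric] eps_powers)
    ultimately show "poly (P i j) (eps ^ 2 * z) * Smat $ j $ j = Smat $ i $ i * poly (P i j) z"
      unfolding gP[OF z(1), symmetric] gP[OF z(2), symmetric] by (simp add: mult_ac)
  qed
  obtain p x y u q v w t s where M: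
    "\<And>z. poly (P 1 1) z = z ^ 3 + p" "\<And>z. poly (P 1 2) z = x * z ^ 2" "\<And>z. poly (P 1 3) z = y * z"
    "\<And>z. poly (P 2 1) z = u * z" "\<And>z. poly (P 2 2) z = z ^ 3 + q" "\<And>z. poly (P 2 3) z = v * z ^ 2"
    "\<And>z. poly (P 3 1) z = w * z ^ 2" "\<And>z. poly (P 3 2) z = t * z" "\<And>z. poly (P 3 3) z = z ^ 3 + s"
    using numerator_graded_form[OF assms(1) deg lead grading] by - (elim exE, rule that, blast+)
  \<comment> \<open>Since \<open>(eps * z) ^ 3 = - (z ^ 3)\<close>, the denominators at
    \<open>eps * z\<close> and at \<open>z\<close> multiply to \<open>c ^ 2 - z ^ 6\<close>.\<close>
  have bil: "\<forall>z. norm z < r \<longrightarrow> poly (P i 1) (eps * z) * poly (P j 2) z - eps * poly (P i 2) (eps * z) * poly (P j 1) z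
      + eps ^ 2 * poly (P i 3) (eps * z) * poly (P j 3) z = Tmat $ i $ j * (c ^ 2 - z ^ 6)" for i j
  proof (intro allI impI)
    fix z :: complex assume "norm z < r"
    then have z: "z \<in> loop_domain r" "eps * z \<in> loop_domain r"
      by (auto intro!: ball simp: norm_mult norm_eps)
    have "(g (eps * z) ** Tmat ** transpose (g z)) $ i $ j = Tmat $ i $ j"
      using Lambda_minus_sigma_bilinear[OF g z(1)] by simp
    then have T: "Tmat $ i $ j = g (eps * z) $ i $ 1 * g z $ j $ 2 - eps * g (eps * z) $ i $ 2 * g z $ j $ 1
        + eps ^ 2 * g (eps * z) $ i $ 3 * g z $ j $ 3"
      by (simp add: matrix_matrix_mult_def sum_3 transpose_def Tmat_def algebra_simps)
    have "(eps * z) ^ 3 = - (z ^ 3)" by (simp add: power_mult_distrib eps_cube)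
    moreover have "z ^ 6 = (z ^ 3) ^ 2" by (simp add: power_mult[symmetric])
    ultimately show "poly (P i 1) (eps * z) * poly (P j 2) z - eps * poly (P i 2) (eps * z) * poly (P j 1) z
      + eps ^ 2 * poly (P i 3) (eps * z) * poly (P j 3) z = Tmat $ i $ j * (c ^ 2 - z ^ 6)"
      unfolding gP[OF z(1), symmetric] gP[OF z(2), symmetric] T c_def[symmetric]
      by (simp add: algebra_simps power2_eq_square)
  qed
  have Tm: "Tmat $ 1 $ 1 = 0" "Tmat $ 1 $ 2 = 1" "Tmat $ 1 $ 3 = 0" "Tmat $ 2 $ 2 = 0"
    "Tmat $ 2 $ 3 = 0" "Tmat $ 3 $ 3 = eps ^ 2"
    by (simp_all add: Tmat_def)
  have ez: "(eps * z) ^ 3 + k = k - z ^ 3" for z k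
    by (simp add: power_mult_distrib eps_cube)
  note eqs = bilinear_parameters[OF assms(1), of p x y u q v c w t s, unfolded case_prod_conv,
    OF bil[of 1 1, unfolded M Tm ez mult_zero_left] bil[of 1 2, unfolded M Tm ez mult_1_left]
      bil[of 1 3, unfolded M Tm ez mult_zero_left] bil[of 2 2, unfolded M Tm ez mult_zero_left]
      bil[of 2 3, unfolded M Tm ez mult_zero_left] bil[of 3 3, unfolded M Tm ez]]
  have "s = 1 * \<alpha> ^ 3 \<or> s = - 1 * \<alpha> ^ 3"
    using eqs(9) unfolding power2_eq_iff by (simp add: c_def)
  then obtain \<delta> where s: "s = \<delta> * \<alpha> ^ 3" and \<delta>: "\<delta> = 1 \<or> \<delta> = - 1" by blast
  have g_eq: "g z = map_matrix (\<lambda>x. x / (z ^ 3 - \<alpha> ^ 3)) (vector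
    [vector [z ^ 3 + p, x * z ^ 2, y * z], vector [u * z, z ^ 3 + q, v * z ^ 2],
     vector [w * z ^ 2, t * z, z ^ 3 + s]])" if "z \<in> loop_domain r" for z
  proof -
    have "g z $ i $ j = poly (P i j) z / (z ^ 3 - \<alpha> ^ 3)" for i j
      using gP[OF that, of i j] cube[OF that] by (simp add: field_simps)
    then show ?thesis by (simp add: vec_eq_iff forall_3 map_matrix_def M)
  qed
  \<comment> \<open>The scalar solution is \<open>(z ^ 3 + s) / (z ^ 3 - \<alpha> ^ 3)\<close> times
    the identity matrix: for \<open>\<delta> = 1\<close> the scalar element excluded by definition,
    for \<open>\<delta> = - 1\<close> the identity, which has no pole.\<close>
  have nontriv: "\<not> (p = s \<and> q = s \<and> x = 0 \<and> y = 0 \<and> u = 0 \<and> v = 0 \<and> t = 0)"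
  proof
    assume "p = s \<and> q = s \<and> x = 0 \<and> y = 0 \<and> u = 0 \<and> v = 0 \<and> t = 0"
    then have "g z = mat ((z ^ 3 + s) / (z ^ 3 - \<alpha> ^ 3))" if "z \<in> loop_domain r" for z
      using eqs(7) by (simp add: g_eq[OF that] vec_eq_iff forall_3 map_matrix_def mat_def)
    with not_scalar not_id \<delta> s cube show False by auto
  qed
  define a where "a = \<delta> * v / (2 * \<alpha>)"
  define b where "b = t / (2 * \<alpha> ^ 2)"
  have "\<delta> ^ 2 = 1" using \<delta> by auto
  note sol = bilinear_parameters_solution[OF \<alpha> eqs(1) eqs(2,3,4)[unfolded c_def] eqs(5)[unfolded eqs(7)]
    eqs(6) eqs(8)[unfolded eqs(7)] s \<open>\<delta> ^ 2 = 1\<close> nontriv, folded a_def b_def]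
  from \<delta> have "(\<forall>z\<in>loop_domain r. g z = g_loop \<alpha> a b z) \<or> (\<forall>z\<in>loop_domain r. g z = h_loop \<alpha> a b z)"
  proof
    assume "\<delta> = 1"
    then have "g z = g_loop \<alpha> a b z" if "z \<in> loop_domain r" for z
      unfolding g_eq[OF that] g_loop_entries[OF cube[OF that] sol(1)] eqs(7) s
      by (simp only: sol(2-) mult_1_left)
    then show ?thesis by blast
  next
    assume "\<delta> = - 1"
    then have "g z = h_loop \<alpha> a b z" if "z \<in> loop_domain r" for z
      unfolding g_eq[OF that] h_loop_entries[OF cube[OF that] sol(1)] eqs(7) s
      by (simp only: sol(2-)) simp
    then show ?thesis by blast
  qed
  with \<alpha> sol(1) show ?thesis by (auto simp: line_subset_Delta_iff)
qed

end
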